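(* Let $\epsilon\in(0,1)$, let $\{e_n\}_{n\ge0}$ be the standard orthonormal basis of $\ell^2(\mathbb{N})$ (complex square-summable sequences indexed from $0$), and let $T$ be the unilateral weighted shift on $\ell^2(\mathbb{N})$ defined by $Te_n=\alpha_ne_{n+1}$ for all $n\ge0$, where $\alpha_n=1$ if $n$ is even and $\alpha_n=\epsilon$ if $n$ is odd. Then for every $\lambda\in(0,1)$, $$r_\sigma(M_\lambda(T))>r_\sigma(T).$$ Consequently the inequality $r_\sigma(M_\lambda(T))\le r_\sigma(T)$ fails in general for $\lambda\in(0,1)$.
   Context: For a bounded operator $T$ on a complex Hilbert space, $|T|=(T^*T)^{1/2}$ and $T=U|T|$ is the canonical polar decomposition ($U$ a partial isometry with $\ker U=\ker T$). The Duggal transform is $T^D=|T|U$, and for $\lambda\in[0,1]$ the $\lambda$-mean transform is $M_\lambda(T)=\lambda T+(1-\lambda)T^D$. $r_\sigma(\cdot)$ denotes the spectral radius. *)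

theory Defs
  imports "HOL-Analysis.Analysis"
begin

section \<open>Complex Hilbert spaces\<close>

class complex_vector = real_vector +
  fixes scaleC :: "complex \<Rightarrow> 'a \<Rightarrow> 'a" (infixr "*\<^sub>C" 75)
  assumes scaleC_add_right: "a *\<^sub>C (x + y) = a *\<^sub>C x + a *\<^sub>C y"
    and scaleC_add_left: "(a + b) *\<^sub>C x = a *\<^sub>C x + b *\<^sub>C x"
    and scaleC_scaleC: "a *\<^sub>C b *\<^sub>C x = (a * b) *\<^sub>C x"
    and scaleC_of_real: "complex_of_real r *\<^sub>C x = r *\<^sub>R x"

text \<open>The complex inner product is linear in its first argument. Its positive definiteness and
  the relation to the norm come from the axioms of \<^class>\<open>real_inner\<close> through
  \<open>inner_eq_Re_cinner\<close>.\<close>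

class complex_inner = complex_vector + real_inner +
  fixes cinner :: "'a \<Rightarrow> 'a \<Rightarrow> complex"
  assumes cinner_commute: "cinner x y = cnj (cinner y x)"
    and cinner_add_left: "cinner (x + y) z = cinner x z + cinner y z"
    and cinner_scaleC_left: "cinner (a *\<^sub>C x) y = a * cinner x y"
    and inner_eq_Re_cinner: "inner x y = Re (cinner x y)"

class chilbert_space = complex_inner + complete_space


section \<open>Bounded operators, polar decomposition and mean transform\<close>

definition bounded_clinear :: "('a::complex_inner \<Rightarrow> 'b::complex_inner) \<Rightarrow> bool" where
  "bounded_clinear T \<longleftrightarrow> bounded_linear T \<and> (\<forall>c x. T (c *\<^sub>C x) = c *\<^sub>C T x)"

definition cadjoint :: "('a::chilbert_space \<Rightarrow> 'a) \<Rightarrow> 'a \<Rightarrow> 'a" where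
  "cadjoint T = (THE S. bounded_clinear S \<and> (\<forall>x y. cinner (T x) y = cinner x (S y)))"

definition positive_op :: "('a::chilbert_space \<Rightarrow> 'a) \<Rightarrow> bool" where
  "positive_op A \<longleftrightarrow> bounded_clinear A \<and> (\<forall>x. cinner (A x) x \<in> \<real>\<^sub>\<ge>\<^sub>0)"

definition sqrt_op :: "('a::chilbert_space \<Rightarrow> 'a) \<Rightarrow> 'a \<Rightarrow> 'a" where
  "sqrt_op A = (THE B. positive_op B \<and> B \<circ> B = A)"

definition abs_op :: "('a::chilbert_space \<Rightarrow> 'a) \<Rightarrow> 'a \<Rightarrow> 'a" where
  "abs_op T = sqrt_op (cadjoint T \<circ> T)"

text \<open>A partial isometry is isometric on the orthogonal complement of its kernel.\<close>

definition partial_isometry :: "('a::chilbert_space \<Rightarrow> 'a) \<Rightarrow> bool" where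
  "partial_isometry U \<longleftrightarrow> bounded_clinear U \<and>
     (\<forall>x. (\<forall>y. U y = 0 \<longrightarrow> cinner x y = 0) \<longrightarrow> norm (U x) = norm x)"

text \<open>The factor \<open>U\<close> of the canonical polar decomposition \<open>T = U|T|\<close>.\<close>

definition polar_isometry :: "('a::chilbert_space \<Rightarrow> 'a) \<Rightarrow> 'a \<Rightarrow> 'a" where
  "polar_isometry T = (THE U. partial_isometry U \<and> {x. U x = 0} = {x. T x = 0} \<and>
     T = U \<circ> abs_op T)"

definition duggal :: "('a::chilbert_space \<Rightarrow> 'a) \<Rightarrow> 'a \<Rightarrow> 'a" where
  "duggal T = abs_op T \<circ> polar_isometry T"

definition mean_transform :: "real \<Rightarrow> ('a::chilbert_space \<Rightarrow> 'a) \<Rightarrow> 'a \<Rightarrow> 'a" where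
  "mean_transform l T = (\<lambda>x. l *\<^sub>R T x + (1 - l) *\<^sub>R duggal T x)"

definition op_spectrum :: "('a::chilbert_space \<Rightarrow> 'a) \<Rightarrow> complex set" where
  "op_spectrum T = {z. \<not> (\<exists>S. bounded_clinear S \<and>
     S \<circ> (\<lambda>x. T x - z *\<^sub>C x) = id \<and> (\<lambda>x. T x - z *\<^sub>C x) \<circ> S = id)}"

definition op_spectral_radius :: "('a::chilbert_space \<Rightarrow> 'a) \<Rightarrow> real" where
  "op_spectral_radius T = (SUP z\<in>op_spectrum T. cmod z)"


section \<open>The Hilbert space of square-summable complex sequences\<close>

typedef ell2 = "{x :: nat \<Rightarrow> complex. summable (\<lambda>n. (cmod (x n))\<^sup>2)}"
  morphisms ell2_nth Abs_ell2
  by (rule exI[of _ "\<lambda>_. 0"]) simp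

setup_lifting type_definition_ell2

lemma ell2_summable: "summable (\<lambda>n. (cmod (ell2_nth x n))\<^sup>2)"
  using ell2_nth[of x] by simp

lemma square_summable_add:
  fixes x y :: "nat \<Rightarrow> complex"
  assumes "summable (\<lambda>n. (cmod (x n))\<^sup>2)" "summable (\<lambda>n. (cmod (y n))\<^sup>2)"
  shows "summable (\<lambda>n. (cmod (x n + y n))\<^sup>2)"
proof (rule summable_comparison_test')
  show "summable (\<lambda>n. 2 * (cmod (x n))\<^sup>2 + 2 * (cmod (y n))\<^sup>2)"
    using assms by (intro summable_add summable_mult)
  show "norm ((cmod (x n + y n))\<^sup>2) \<le> 2 * (cmod (x n))\<^sup>2 + 2 * (cmod (y n))\<^sup>2" for n
  proof -
    have "(cmod (x n + y n))\<^sup>2 \<le> (cmod (x n) + cmod (y n))\<^sup>2"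
      by (intro power_mono norm_triangle_ineq norm_ge_zero)
    also have "\<dots> \<le> 2 * (cmod (x n))\<^sup>2 + 2 * (cmod (y n))\<^sup>2"
      using sum_squares_bound[of "cmod (x n)" "cmod (y n)"] by (simp add: power2_sum)
    finally show ?thesis by simp
  qed
qed

lemma square_summable_scale:
  fixes x :: "nat \<Rightarrow> complex"
  assumes "summable (\<lambda>n. (cmod (x n))\<^sup>2)"
  shows "summable (\<lambda>n. (cmod (c * x n))\<^sup>2)"
  using summable_mult[OF assms, of "(cmod c)\<^sup>2"] by (simp add: norm_mult power_mult_distrib)

lemma ell2_summable_cinner: "summable (\<lambda>n. ell2_nth x n * cnj (ell2_nth y n))"
proof (rule summable_comparison_test')
  show "summable (\<lambda>n. (cmod (ell2_nth x n))\<^sup>2 + (cmod (ell2_nth y n))\<^sup>2)"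
    by (intro summable_add ell2_summable)
  show "norm (ell2_nth x n * cnj (ell2_nth y n))
      \<le> (cmod (ell2_nth x n))\<^sup>2 + (cmod (ell2_nth y n))\<^sup>2" for n
  proof -
    have "2 * (cmod (ell2_nth x n) * cmod (ell2_nth y n))
      \<le> (cmod (ell2_nth x n))\<^sup>2 + (cmod (ell2_nth y n))\<^sup>2"
      using sum_squares_bound[of "cmod (ell2_nth x n)" "cmod (ell2_nth y n)"] by simp
    moreover have "0 \<le> cmod (ell2_nth x n) * cmod (ell2_nth y n)" by simp
    ultimately have "cmod (ell2_nth x n) * cmod (ell2_nth y n)
      \<le> (cmod (ell2_nth x n))\<^sup>2 + (cmod (ell2_nth y n))\<^sup>2"
      by linarith
    then show ?thesis by (simp add: norm_mult)
  qed
qed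

instantiation ell2 :: complex_inner
begin

lift_definition zero_ell2 :: ell2 is "\<lambda>_. 0" by simp

lift_definition plus_ell2 :: "ell2 \<Rightarrow> ell2 \<Rightarrow> ell2" is "\<lambda>x y n. x n + y n"
  by (rule square_summable_add)

lift_definition uminus_ell2 :: "ell2 \<Rightarrow> ell2" is "\<lambda>x n. - x n" by simp

lift_definition minus_ell2 :: "ell2 \<Rightarrow> ell2 \<Rightarrow> ell2" is "\<lambda>x y n. x n - y n"
  subgoal for x y
    using square_summable_add[of x "\<lambda>n. - y n"] by simp
  done

lift_definition scaleC_ell2 :: "complex \<Rightarrow> ell2 \<Rightarrow> ell2" is "\<lambda>c x n. c * x n"
  by (rule square_summable_scale)

definition scaleR_ell2 :: "real \<Rightarrow> ell2 \<Rightarrow> ell2" where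
  "scaleR_ell2 r x = complex_of_real r *\<^sub>C x"

lift_definition cinner_ell2 :: "ell2 \<Rightarrow> ell2 \<Rightarrow> complex" is
  "\<lambda>x y. \<Sum>n. x n * cnj (y n)" .

definition inner_ell2 :: "ell2 \<Rightarrow> ell2 \<Rightarrow> real" where
  "inner_ell2 x y = Re (cinner x y)"

definition norm_ell2 :: "ell2 \<Rightarrow> real" where
  "norm_ell2 x = sqrt (inner x x)"

definition dist_ell2 :: "ell2 \<Rightarrow> ell2 \<Rightarrow> real" where
  "dist_ell2 x y = norm (x - y)"

definition sgn_ell2 :: "ell2 \<Rightarrow> ell2" where
  "sgn_ell2 x = inverse (norm x) *\<^sub>R x"

definition uniformity_ell2 :: "(ell2 \<times> ell2) filter" where
  "uniformity_ell2 = (INF e\<in>{0<..}. principal {(x, y). dist x y < e})"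

definition open_ell2 :: "ell2 set \<Rightarrow> bool" where
  "open_ell2 U \<longleftrightarrow> (\<forall>x\<in>U. \<forall>\<^sub>F (x', y) in uniformity. x' = x \<longrightarrow> y \<in> U)"

instance
proof
  fix x y z :: ell2 and a b :: complex and r s :: real
  show "x + y + z = x + (y + z)" by transfer (simp add: algebra_simps)
  show "x + y = y + x" by transfer (simp add: algebra_simps)
  show "0 + x = x" by transfer simp
  show "- x + x = 0" by transfer simp
  show "x - y = x + - y" by transfer simp
  show cadd: "a *\<^sub>C (x + y) = a *\<^sub>C x + a *\<^sub>C y" for a :: complex and x y :: ell2
    by transfer (simp add: algebra_simps)
  show cadd': "(a + b) *\<^sub>C x = a *\<^sub>C x + b *\<^sub>C x" for a b :: complex and x :: ell2
    by transfer (simp add: algebra_simps)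
  show csc: "a *\<^sub>C b *\<^sub>C x = (a * b) *\<^sub>C x" for a b :: complex and x :: ell2
    by transfer (simp add: algebra_simps)
  show "complex_of_real r *\<^sub>C x = r *\<^sub>R x" by (simp add: scaleR_ell2_def)
  show "r *\<^sub>R (x + y) = r *\<^sub>R x + r *\<^sub>R y" by (simp add: scaleR_ell2_def cadd)
  show "(r + s) *\<^sub>R x = r *\<^sub>R x + s *\<^sub>R x" by (simp add: scaleR_ell2_def cadd')
  show "r *\<^sub>R s *\<^sub>R x = (r * s) *\<^sub>R x" by (simp add: scaleR_ell2_def csc)
  show "1 *\<^sub>R x = x" unfolding scaleR_ell2_def by transfer simp
  show comm: "cinner x y = cnj (cinner y x)" for x y :: ell2
  proof -
    have "(\<lambda>n. ell2_nth y n * cnj (ell2_nth x n)) sums cinner y x"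
      using ell2_summable_cinner[of y x] by (simp add: cinner_ell2.rep_eq summable_sums)
    from bounded_linear.sums[OF bounded_linear_cnj this]
    have "(\<lambda>n. ell2_nth x n * cnj (ell2_nth y n)) sums cnj (cinner y x)"
      by (simp add: mult.commute)
    then show ?thesis by (simp add: cinner_ell2.rep_eq sums_unique[symmetric])
  qed
  show add: "cinner (x + y) z = cinner x z + cinner y z"
    by (simp add: cinner_ell2.rep_eq plus_ell2.rep_eq distrib_right
        suminf_add[OF ell2_summable_cinner ell2_summable_cinner])
  show scal: "cinner (a *\<^sub>C x) y = a * cinner x y" for a :: complex and x y :: ell2
    by (simp add: cinner_ell2.rep_eq scaleC_ell2.rep_eq mult.assoc
        suminf_mult[OF ell2_summable_cinner])
  show "inner x y = Re (cinner x y)" by (simp add: inner_ell2_def)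
  show "inner x y = inner y x"
    using comm[of x y] by (simp add: inner_ell2_def)
  show "inner (x + y) z = inner x z + inner y z"
    by (simp add: inner_ell2_def add)
  show "inner (r *\<^sub>R x) y = r * inner x y"
    by (simp add: inner_ell2_def scaleR_ell2_def scal)
  have inn: "inner x x = (\<Sum>n. (cmod (ell2_nth x n))\<^sup>2)"
  proof -
    have "cinner x x = (\<Sum>n. complex_of_real ((cmod (ell2_nth x n))\<^sup>2))"
      by (simp only: cinner_ell2.rep_eq complex_norm_square)
    also have "\<dots> = complex_of_real (\<Sum>n. (cmod (ell2_nth x n))\<^sup>2)"
      by (rule suminf_of_real[OF ell2_summable, symmetric])
    finally show ?thesis by (simp add: inner_ell2_def)
  qed
  show "0 \<le> inner x x"
    unfolding inn by (rule suminf_nonneg[OF ell2_summable]) simp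
  show "inner x x = 0 \<longleftrightarrow> x = 0"
  proof -
    have "inner x x = 0 \<longleftrightarrow> (\<forall>n. ell2_nth x n = 0)"
      unfolding inn using suminf_eq_zero_iff[OF ell2_summable, of x] by simp
    also have "\<dots> \<longleftrightarrow> x = 0" by transfer auto
    finally show ?thesis .
  qed
qed (simp_all add: norm_ell2_def dist_ell2_def sgn_ell2_def uniformity_ell2_def open_ell2_def)

end

lemma ell2_norm_square: "(norm x)\<^sup>2 = (\<Sum>n. (cmod (ell2_nth x n))\<^sup>2)"
proof -
  have "cinner x x = (\<Sum>n. complex_of_real ((cmod (ell2_nth x n))\<^sup>2))"
    by (simp only: cinner_ell2.rep_eq complex_norm_square)
  also have "\<dots> = complex_of_real (\<Sum>n. (cmod (ell2_nth x n))\<^sup>2)"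
    by (rule suminf_of_real[OF ell2_summable, symmetric])
  finally show ?thesis by (simp add: power2_norm_eq_inner inner_eq_Re_cinner)
qed

lemma ell2_sum_le_norm: "(\<Sum>n<k. (cmod (ell2_nth x n))\<^sup>2) \<le> (norm x)\<^sup>2"
  unfolding ell2_norm_square by (rule sum_le_suminf[OF ell2_summable]) auto

lemma ell2_nth_le_norm: "cmod (ell2_nth x n) \<le> norm x"
proof -
  have "(cmod (ell2_nth x n))\<^sup>2 \<le> (\<Sum>i<Suc n. (cmod (ell2_nth x i))\<^sup>2)"
    by (rule member_le_sum) auto
  also have "\<dots> \<le> (norm x)\<^sup>2" by (rule ell2_sum_le_norm)
  finally show ?thesis by (rule power2_le_imp_le) simp
qed

instance ell2 :: chilbert_space
proof
  fix X :: "nat \<Rightarrow> ell2"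
  assume "Cauchy X"
  then have cau: "\<exists>N. \<forall>m\<ge>N. \<forall>n\<ge>N. norm (X m - X n) < e" if "e > 0" for e
    using that by (auto simp: Cauchy_def dist_norm)
  have "Cauchy (\<lambda>m. ell2_nth (X m) k)" for k
  proof (rule metric_CauchyI)
    fix e :: real assume "e > 0"
    then obtain N where N: "\<forall>m\<ge>N. \<forall>n\<ge>N. norm (X m - X n) < e" using cau by blast
    have "dist (ell2_nth (X m) k) (ell2_nth (X n) k) < e" if "m \<ge> N" "n \<ge> N" for m n
      using ell2_nth_le_norm[of "X m - X n" k] N that
      by (force simp: dist_norm minus_ell2.rep_eq)
    then show "\<exists>N. \<forall>m\<ge>N. \<forall>n\<ge>N. dist (ell2_nth (X m) k) (ell2_nth (X n) k) < e" by blast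
  qed
  then have "\<exists>l. (\<lambda>m. ell2_nth (X m) k) \<longlonglongrightarrow> l" for k
    using Cauchy_convergent_iff convergent_def by blast
  then obtain L where L: "\<And>k. (\<lambda>m. ell2_nth (X m) k) \<longlonglongrightarrow> L k" by metis
  have part: "(\<Sum>k<K. (cmod (ell2_nth (X m) k - L k))\<^sup>2) \<le> e\<^sup>2"
    if N: "\<forall>m\<ge>N. \<forall>n\<ge>N. norm (X m - X n) < e" and m: "m \<ge> N" for N m e K
  proof (rule LIMSEQ_le_const2)
    show "(\<lambda>n. \<Sum>k<K. (cmod (ell2_nth (X m) k - ell2_nth (X n) k))\<^sup>2)
        \<longlonglongrightarrow> (\<Sum>k<K. (cmod (ell2_nth (X m) k - L k))\<^sup>2)"
      by (intro tendsto_intros L)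
    have "(\<Sum>k<K. (cmod (ell2_nth (X m) k - ell2_nth (X n) k))\<^sup>2) \<le> e\<^sup>2" if "n \<ge> N" for n
    proof -
      have "(norm (X m - X n))\<^sup>2 \<le> e\<^sup>2"
        using N m that by (intro power_mono) (auto intro: less_imp_le)
      then show ?thesis
        using ell2_sum_le_norm[of "X m - X n" K] by (simp add: minus_ell2.rep_eq)
    qed
    then show "\<exists>N. \<forall>n\<ge>N. (\<Sum>k<K. (cmod (ell2_nth (X m) k - ell2_nth (X n) k))\<^sup>2) \<le> e\<^sup>2"
      by blast
  qed
  have summ: "summable (\<lambda>k. (cmod (ell2_nth (X m) k - L k))\<^sup>2)"
    if "\<forall>m\<ge>N. \<forall>n\<ge>N. norm (X m - X n) < e" and "m \<ge> N" for N m e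
  proof (rule bounded_imp_summable)
    show "0 \<le> (cmod (ell2_nth (X m) k - L k))\<^sup>2" for k by simp
    show "(\<Sum>k\<le>K. (cmod (ell2_nth (X m) k - L k))\<^sup>2) \<le> e\<^sup>2" for K
      using part[OF that, of "Suc K"] by (simp only: lessThan_Suc_atMost)
  qed
  obtain N where N: "\<forall>m\<ge>N. \<forall>n\<ge>N. norm (X m - X n) < 1" using cau[of 1] by auto
  have "summable (\<lambda>k. (cmod (- 1 * (ell2_nth (X N) k - L k)))\<^sup>2)"
    by (rule square_summable_scale) (rule summ[OF N order_refl])
  from square_summable_add[OF ell2_summable[of "X N"] this]
  have "summable (\<lambda>k. (cmod (L k))\<^sup>2)" by simp
  then obtain Y where Y: "ell2_nth Y = L" using Abs_ell2_inverse[of L] by blast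
  have "X \<longlonglongrightarrow> Y"
  proof (rule LIMSEQ_I)
    fix e :: real assume "e > 0"
    then obtain M where M: "\<forall>m\<ge>M. \<forall>n\<ge>M. norm (X m - X n) < e / 2"
      using cau[of "e / 2"] by auto
    have "norm (X m - Y) < e" if "m \<ge> M" for m
    proof -
      have "(norm (X m - Y))\<^sup>2 = (\<Sum>k. (cmod (ell2_nth (X m) k - L k))\<^sup>2)"
        by (simp add: ell2_norm_square minus_ell2.rep_eq Y)
      also have "\<dots> \<le> (e / 2)\<^sup>2"
        by (rule suminf_le_const[OF summ[OF M that]]) (rule part[OF M that])
      finally have "norm (X m - Y) \<le> e / 2" by (rule power2_le_imp_le) (use \<open>e > 0\<close> in simp)
      then show ?thesis using \<open>e > 0\<close> by simp
    qed
    then show "\<exists>no. \<forall>n\<ge>no. norm (X n - Y) < e" by blast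
  qed
  then show "convergent X" by (auto simp: convergent_def)
qed

lift_definition ell2_basis :: "nat \<Rightarrow> ell2" is "\<lambda>n k. if k = n then 1 else 0"
  subgoal for n
    by (rule summable_finite[of "{n}"]) auto
  done

end

theory Submission
  imports Defs
begin

text \<open>A weighted shift \<open>W\<close> whose weights alternate between \<open>a\<close> and \<open>b\<close> satisfies
  \<open>W\<^sup>2 = ab S\<^sup>2\<close> with \<open>S\<close> the isometric unilateral shift, so its spectral radius is \<open>sqrt (ab)\<close>.
  For \<open>T\<close> itself the two weights are \<open>1\<close> and \<open>\<epsilon>\<close>. Since \<open>|T|\<close> is diagonal with entries
  \<open>\<alpha>\<^sub>n\<close> and \<open>U = S\<close>, the Duggal transform swaps the two weights, and the mean transform
  has weights \<open>\<lambda> + (1 - \<lambda>)\<epsilon>\<close> and \<open>\<lambda>\<epsilon> + (1 - \<lambda>)\<close>, whose product exceeds \<open>\<epsilon>\<close> by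
  \<open>\<lambda>(1 - \<lambda>)(1 - \<epsilon>)\<^sup>2\<close>.\<close>

section \<open>Bounded operators on complex Hilbert spaces\<close>

lemma cinner_add_right: "cinner x (y + z) = cinner x y + cinner x z"
  for x y z :: "'a::complex_inner"
  by (metis cinner_add_left cinner_commute complex_cnj_add)

lemma cinner_scaleC_right: "cinner x (c *\<^sub>C y) = cnj c * cinner x y"
  for x y :: "'a::complex_inner"
  by (metis cinner_commute cinner_scaleC_left complex_cnj_mult)

lemma cinner_self: "cinner x x = of_real ((norm x)\<^sup>2)" for x :: "'a::complex_inner"
proof (rule complex_eqI)
  show "Re (cinner x x) = Re (of_real ((norm x)\<^sup>2))"
    by (simp add: power2_norm_eq_inner inner_eq_Re_cinner)
  have "Im (cinner x x) = - Im (cinner x x)"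
    using arg_cong[OF cinner_commute[of x x], of Im] by simp
  then show "Im (cinner x x) = Im (of_real ((norm x)\<^sup>2))" by simp
qed

lemma norm_scaleC: "norm (c *\<^sub>C x) = cmod c * norm x" for x :: "'a::complex_inner"
proof -
  have "complex_of_real ((norm (c *\<^sub>C x))\<^sup>2) = of_real ((cmod c * norm x)\<^sup>2)"
    unfolding cinner_self[symmetric] cinner_scaleC_left cinner_scaleC_right
    by (simp add: cinner_self power_mult_distrib complex_norm_square mult_ac flip: of_real_power)
  then have "(norm (c *\<^sub>C x))\<^sup>2 = (cmod c * norm x)\<^sup>2"
    using of_real_eq_iff by blast
  then show ?thesis by (simp add: power2_eq_iff_nonneg)
qed

lemma scaleR_scaleC: "r *\<^sub>R x = complex_of_real r *\<^sub>C x" for x :: "'a::complex_vector"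
  by (simp add: scaleC_of_real)

lemma scaleC_zero_left: "0 *\<^sub>C x = 0" for x :: "'a::complex_vector"
  using scaleC_of_real[of 0 x] by simp

lemma scaleC_one: "1 *\<^sub>C x = x" for x :: "'a::complex_vector"
  using scaleC_of_real[of 1 x] by simp

lemma scaleC_scaleR_commute: "c *\<^sub>C (r *\<^sub>R x) = r *\<^sub>R (c *\<^sub>C x)" for x :: "'a::complex_vector"
  by (simp add: scaleR_scaleC scaleC_scaleC mult.commute)

lemma scaleC_minus_right: "c *\<^sub>C (- x) = - (c *\<^sub>C x)" for x :: "'a::complex_vector"
  using scaleC_scaleR_commute[of c "-1" x] by simp

lemma scaleC_diff_right: "c *\<^sub>C (x - y) = c *\<^sub>C x - c *\<^sub>C y" for x y :: "'a::complex_vector"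
  using scaleC_add_right[of c x "- y"] by (simp add: scaleC_minus_right)

lemma bounded_clinearI:
  assumes "\<And>x y. T (x + y) = T x + T y" "\<And>c x. T (c *\<^sub>C x) = c *\<^sub>C T x"
    and "\<And>x. norm (T x) \<le> C * norm x"
  shows "bounded_clinear T"
  unfolding bounded_clinear_def
proof (intro conjI allI bounded_linear_intro)
  show "T (r *\<^sub>R x) = r *\<^sub>R T x" for r x
    by (simp add: scaleR_scaleC assms(2))
  show "norm (T x) \<le> norm x * C" for x
    using assms(3)[of x] by (simp add: mult.commute)
qed (use assms in auto)

lemma bounded_clinear_scaleC_left: "bounded_clinear (\<lambda>x. c *\<^sub>C x)"
  by (rule bounded_clinearI[where C = "cmod c"])
    (simp_all add: scaleC_add_right scaleC_scaleC mult.commute norm_scaleC)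

context
  fixes T :: "'a::complex_inner \<Rightarrow> 'b::complex_inner"
  assumes T: "bounded_clinear T"
begin

lemma bounded_clinear_bounded_linear: "bounded_linear T"
  using T by (simp add: bounded_clinear_def)

lemma bounded_clinear_scaleC: "T (c *\<^sub>C x) = c *\<^sub>C T x"
  using T by (simp add: bounded_clinear_def)

lemma bounded_clinear_add: "T (x + y) = T x + T y"
  using bounded_clinear_bounded_linear by (rule linear_add[OF bounded_linear.linear])

lemma bounded_clinear_diff: "T (x - y) = T x - T y"
  using bounded_clinear_bounded_linear by (rule linear_diff[OF bounded_linear.linear])

lemma bounded_clinear_scaleR: "T (r *\<^sub>R x) = r *\<^sub>R T x"
  using bounded_clinear_bounded_linear by (rule linear_cmul[OF bounded_linear.linear])

lemma bounded_clinear_zero: "T 0 = 0"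
  using bounded_clinear_bounded_linear by (rule linear_0[OF bounded_linear.linear])

end

lemma bounded_clinear_compose:
  "bounded_clinear S \<Longrightarrow> bounded_clinear T \<Longrightarrow> bounded_clinear (S \<circ> T)"
  unfolding bounded_clinear_def o_def by (auto intro: bounded_linear_compose)

lemma bounded_clinear_plus:
  "bounded_clinear S \<Longrightarrow> bounded_clinear T \<Longrightarrow> bounded_clinear (\<lambda>x. S x + T x)"
  unfolding bounded_clinear_def by (auto intro: bounded_linear_add simp: scaleC_add_right)

section \<open>Adjoints and positive square roots\<close>

lemma cadjoint_eqI:
  assumes "bounded_clinear S" "\<And>x y. cinner (T x) y = cinner x (S y)"
  shows "cadjoint T = S"
  unfolding cadjoint_def
proof (rule the_equality)
  fix S' assume S': "bounded_clinear S' \<and> (\<forall>x y. cinner (T x) y = cinner x (S' y))"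
  show "S' = S"
  proof
    fix y
    \<comment> \<open>\<open>cadjoint\<close> is a definite description, so every competitor
      \<open>S'\<close> has to be excluded: the difference of the two values is orthogonal to
      itself.\<close>
    let ?d = "S' y - S y"
    have "cinner ?d (S' y) = cinner ?d ?d + cinner ?d (S y)"
      by (simp add: cinner_add_right[symmetric])
    moreover have "cinner ?d (S' y) = cinner ?d (S y)"
      using S' assms(2) by metis
    ultimately show "S' y = S y" by (simp add: cinner_self)
  qed
qed (use assms in auto)

text \<open>The vector \<open>v = B x - c x\<close> satisfies \<open>B v = - c v\<close>, and a
  positive operator has no eigenvector for a negative eigenvalue. This determines the positive
  square root of a diagonal operator without any functional calculus.\<close>

lemma positive_sqrt_eigenvector:
  assumes B: "positive_op B" and "0 < c" and BB: "B (B x) = (c * c) *\<^sub>R x"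
  shows "B x = c *\<^sub>R x"
proof -
  have lin: "bounded_clinear B" using B by (simp add: positive_op_def)
  define v where "v = B x - c *\<^sub>R x"
  have "B v = - c *\<^sub>R v"
    by (simp add: v_def bounded_clinear_diff[OF lin] bounded_clinear_scaleR[OF lin] BB algebra_simps)
  then have "cinner (B v) v = of_real (- c * (norm v)\<^sup>2)"
    by (simp add: scaleR_scaleC cinner_scaleC_left cinner_self del: scaleC_of_real)
  moreover have "cinner (B v) v \<in> \<real>\<^sub>\<ge>\<^sub>0" using B by (simp add: positive_op_def)
  ultimately have "0 \<le> - c * (norm v)\<^sup>2"
    by (metis complex_nonneg_Reals_iff complex.sel(1) Re_complex_of_real)
  then have "(norm v)\<^sup>2 \<le> 0" using \<open>0 < c\<close> by (simp add: mult_le_0_iff)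
  then show ?thesis by (simp add: v_def)
qed

section \<open>Inverting the identity minus a contraction, and a spectral bound\<close>

lemma bounded_clinear_inverse_id_minus:
  fixes A :: "'a::chilbert_space \<Rightarrow> 'a"
  assumes A: "bounded_clinear A" and q: "q < 1" and le: "\<And>x. norm (A x) \<le> q * norm x"
  obtains R where "bounded_clinear R" "\<And>y. R y - A (R y) = y"
proof -
  have ex: "\<exists>x. x - A x = y" for y
  proof -
    \<comment> \<open>A preimage of \<open>y\<close> under the identity minus \<open>A\<close> is a
      fixed point of this affine contraction. The sign of \<open>q\<close> is not assumed, whence
      the constant \<open>max q 0\<close>.\<close>
    have "\<exists>!x. y + A x = x"
    proof (rule banach_fix_type[where c = "max q 0"], goal_cases)
      case 3
      have "dist (y + A u) (y + A v) \<le> max q 0 * dist u v" for u v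
      proof -
        have "dist (y + A u) (y + A v) = norm (A (u - v))"
          by (simp add: dist_norm bounded_clinear_diff[OF A])
        also have "\<dots> \<le> max q 0 * norm (u - v)"
          by (rule order_trans[OF le]) (simp add: mult_right_mono)
        finally show ?thesis by (simp add: dist_norm)
      qed
      then show ?case by blast
    qed (use q in auto)
    then show ?thesis by (metis add_diff_cancel_right')
  qed
  \<comment> \<open>This lower estimate serves twice: it makes the identity minus \<open>A\<close>
    injective, so that the chosen preimages depend linearly on \<open>y\<close>, and it bounds the
    preimage map \<open>R\<close>.\<close>
  have low: "norm x \<le> inverse (1 - q) * norm (x - A x)" for x
  proof -
    have "norm x \<le> norm (x - A x) + norm (A x)" by (metis norm_triangle_sub add.commute)
    then have "(1 - q) * norm x \<le> norm (x - A x)" using le[of x] by (simp add: algebra_simps)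
    then show ?thesis using q by (simp add: field_simps)
  qed
  have inj: "u = v" if "u - A u = v - A v" for u v
    using low[of "u - v"] that by (simp add: bounded_clinear_diff[OF A] algebra_simps)
  obtain R where R: "\<And>y. R y - A (R y) = y" using ex by metis
  have "bounded_clinear R"
  proof (rule bounded_clinearI[where C = "inverse (1 - q)"])
    show "R (x + y) = R x + R y" for x y
    proof (rule inj)
      have "R x + R y - A (R x + R y) = (R x - A (R x)) + (R y - A (R y))"
        by (simp add: bounded_clinear_add[OF A])
      then show "R (x + y) - A (R (x + y)) = R x + R y - A (R x + R y)" by (simp add: R)
    qed
    show "R (c *\<^sub>C x) = c *\<^sub>C R x" for c x
    proof (rule inj)
      have "c *\<^sub>C R x - A (c *\<^sub>C R x) = c *\<^sub>C (R x - A (R x))"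
        by (simp add: bounded_clinear_scaleC[OF A] scaleC_diff_right)
      then show "R (c *\<^sub>C x) - A (R (c *\<^sub>C x)) = c *\<^sub>C R x - A (c *\<^sub>C R x)" by (simp add: R)
    qed
    show "norm (R x) \<le> inverse (1 - q) * norm x" for x
      using low[of "R x"] by (simp add: R)
  qed
  then show thesis using R that by blast
qed

text \<open>By the factorisation \<open>z\<^sup>2 - W\<^sup>2 = (z - W)(z + W)\<close>.\<close>

lemma op_spectrum_bound_square:
  fixes W :: "'a::chilbert_space \<Rightarrow> 'a"
  assumes W: "bounded_clinear W" and le: "\<And>x. norm (W (W x)) \<le> c * norm x"
    and z: "z \<in> op_spectrum W"
  shows "(cmod z)\<^sup>2 \<le> c \<or> z = 0"
proof (rule ccontr)
  assume "\<not> ((cmod z)\<^sup>2 \<le> c \<or> z = 0)"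
  then have c: "c < (cmod z)\<^sup>2" and z0: "z \<noteq> 0" by auto
  \<comment> \<open>Dividing by \<open>z^2\<close> turns \<open>c < |z|^2\<close> into a contraction
    estimate for \<open>A = W^2 / z^2\<close>.\<close>
  define k where "k = inverse (z\<^sup>2)"
  define A where "A = (\<lambda>x. k *\<^sub>C x) \<circ> (W \<circ> W)"
  have A: "bounded_clinear A"
    unfolding A_def by (intro bounded_clinear_compose bounded_clinear_scaleC_left W)
  have leA: "norm (A x) \<le> (cmod k * c) * norm x" for x
    unfolding A_def o_def norm_scaleC mult.assoc by (intro mult_left_mono le) simp
  have q: "cmod k * c < 1"
    using c z0 by (simp add: k_def norm_inverse norm_power mult.commute divide_inverse[symmetric])
  obtain R where R: "bounded_clinear R" and RA: "\<And>y. R y - A (R y) = y"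
    using bounded_clinear_inverse_id_minus[OF A q leA] by blast
  have k: "k * (z * z) = 1" using z0 by (simp add: k_def flip: power2_eq_square)
  \<comment> \<open>Since \<open>(W - z)(W + z) = - z^2 (1 - A)\<close> and \<open>R\<close> is a
    right inverse of \<open>1 - A\<close>, the map \<open>- k (W + z) R\<close> is a right inverse
    of \<open>W - z\<close>.\<close>
  define S where "S = (\<lambda>y. (- k) *\<^sub>C (W (R y) + z *\<^sub>C R y))"
  have S: "bounded_clinear S"
    using bounded_clinear_compose[OF bounded_clinear_scaleC_left[of "- k"]
        bounded_clinear_plus[OF bounded_clinear_compose[OF W R]
          bounded_clinear_compose[OF bounded_clinear_scaleC_left[of z] R]]]
    by (simp add: S_def o_def)
  have neg: "(- a) *\<^sub>C x = - (a *\<^sub>C x)" for a and x :: 'a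
    using scaleC_add_left[of a "- a" x] by (simp add: scaleC_zero_left eq_neg_iff_add_eq_0 add.commute)
  have W_neg: "W (- x) = - W x" for x
    using bounded_clinear_scaleR[OF W, of "- 1" x] by simp
  note simps = W_neg scaleC_minus_right bounded_clinear_scaleC[OF W] bounded_clinear_add[OF W] bounded_clinear_diff[OF W]
    scaleC_add_right scaleC_diff_right scaleC_scaleC neg
  have right: "W (S y) - z *\<^sub>C S y = y" for y
  proof -
    have "W (S y) - z *\<^sub>C S y = (k * (z * z)) *\<^sub>C R y - k *\<^sub>C W (W (R y))"
      by (simp add: S_def simps algebra_simps)
    also have "\<dots> = y" using RA[of y] by (simp add: k scaleC_one A_def)
    finally show ?thesis .
  qed
  \<comment> \<open>This avoids commuting \<open>R\<close> with \<open>W\<close>: a right inverse of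
    an injective map is also a left inverse. A vector in the kernel of \<open>W - z\<close> would be
    fixed by the contraction \<open>A\<close>.\<close>
  have inj: "x = 0" if "W x - z *\<^sub>C x = 0" for x
  proof -
    have Wx: "W x = z *\<^sub>C x" using that by simp
    have "A x = x" by (simp add: A_def Wx simps k scaleC_one)
    then have "(1 - cmod k * c) * norm x \<le> 0" using leA[of x] by (simp add: algebra_simps)
    then show "x = 0" using q by (simp add: mult_le_0_iff)
  qed
  have left: "S (W x - z *\<^sub>C x) = x" for x
  proof -
    let ?u = "S (W x - z *\<^sub>C x)"
    have "W (?u - x) - z *\<^sub>C (?u - x) = (W ?u - z *\<^sub>C ?u) - (W x - z *\<^sub>C x)"
      by (simp only: simps) simp
    also have "\<dots> = 0" by (simp only: right) simp
    finally show ?thesis using inj[of "?u - x"] by simp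
  qed
  have "z \<notin> op_spectrum W"
    unfolding op_spectrum_def using S left right by (auto simp: fun_eq_iff)
  with z show False by contradiction
qed

section \<open>Shifts and diagonal operators\<close>

lemma ell2_eqI: "(\<And>n. ell2_nth x n = ell2_nth y n) \<Longrightarrow> x = y"
  by (simp add: ell2_nth_inject[symmetric] fun_eq_iff)

lemma ell2_norm_le:
  assumes "0 \<le> C" "\<And>n. cmod (ell2_nth x n) \<le> C * cmod (ell2_nth y n)"
  shows "norm x \<le> C * norm y"
proof (rule power2_le_imp_le)
  have "(norm x)\<^sup>2 \<le> (\<Sum>n. C\<^sup>2 * (cmod (ell2_nth y n))\<^sup>2)"
    unfolding ell2_norm_square
    by (intro suminf_le ell2_summable summable_mult)
      (use assms in \<open>simp add: power_mult_distrib[symmetric] power_mono\<close>)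
  also have "\<dots> = (C * norm y)\<^sup>2"
    by (simp add: suminf_mult[OF ell2_summable] power_mult_distrib ell2_norm_square)
  finally show "(norm x)\<^sup>2 \<le> (C * norm y)\<^sup>2" .
qed (use assms in simp)

lift_definition ell2_shift :: "ell2 \<Rightarrow> ell2" is "\<lambda>x n. case n of 0 \<Rightarrow> 0 | Suc m \<Rightarrow> x m"
  by (subst summable_Suc_iff[symmetric]) simp

lift_definition ell2_backshift :: "ell2 \<Rightarrow> ell2" is "\<lambda>x n. x (Suc n)"
  by (subst (asm) summable_Suc_iff[symmetric]) simp

text \<open>The lifting demands a square-summable result for every \<open>w\<close>, hence the
  guard: for unbounded weights the operator is zero by convention.\<close>

lift_definition ell2_diag :: "(nat \<Rightarrow> real) \<Rightarrow> ell2 \<Rightarrow> ell2" is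
  "\<lambda>w x n. if Bseq w then of_real (w n) * x n else 0"
proof -
  fix w :: "nat \<Rightarrow> real" and x :: "nat \<Rightarrow> complex"
  assume x: "summable (\<lambda>n. (cmod (x n))\<^sup>2)"
  show "summable (\<lambda>n. (cmod (if Bseq w then of_real (w n) * x n else 0))\<^sup>2)"
  proof (cases "Bseq w")
    case True
    then obtain K where K: "\<And>n. \<bar>w n\<bar> \<le> K" by (auto simp: Bseq_def)
    show ?thesis
    proof (rule summable_comparison_test')
      show "summable (\<lambda>n. K\<^sup>2 * (cmod (x n))\<^sup>2)" by (intro summable_mult x)
      have "(\<bar>w n\<bar> * cmod (x n))\<^sup>2 \<le> (K * cmod (x n))\<^sup>2" for n
        by (intro power_mono mult_right_mono K) auto
      then show "norm ((cmod (if Bseq w then of_real (w n) * x n else 0))\<^sup>2) \<le> K\<^sup>2 * (cmod (x n))\<^sup>2"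
        for n using True by (simp add: norm_mult power_mult_distrib)
    qed
  qed simp
qed

lemma ell2_nth_diag: "Bseq w \<Longrightarrow> ell2_nth (ell2_diag w x) n = of_real (w n) * ell2_nth x n"
  by (simp add: ell2_diag.rep_eq)

lemma ell2_nth_scaleR: "ell2_nth (r *\<^sub>R x) n = of_real r * ell2_nth x n"
  by (simp add: scaleR_scaleC scaleC_ell2.rep_eq del: scaleC_of_real)

lemma ell2_nth_sum: "ell2_nth (sum f A) n = (\<Sum>i\<in>A. ell2_nth (f i) n)"
  by (induction A rule: infinite_finite_induct) (simp_all add: zero_ell2.rep_eq plus_ell2.rep_eq)

lemma norm_ell2_shift: "norm (ell2_shift x) = norm x"
proof -
  have "(norm (ell2_shift x))\<^sup>2 = (norm x)\<^sup>2"
    using suminf_split_head[OF ell2_summable[of "ell2_shift x"]]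
    by (simp add: ell2_norm_square ell2_shift.rep_eq)
  then show ?thesis by (simp add: power2_eq_iff_nonneg)
qed

lemma norm_ell2_backshift_le: "norm (ell2_backshift x) \<le> norm x"
proof (rule power2_le_imp_le)
  show "(norm (ell2_backshift x))\<^sup>2 \<le> (norm x)\<^sup>2"
    using suminf_split_head[OF ell2_summable[of x]]
    by (simp add: ell2_norm_square ell2_backshift.rep_eq)
qed simp

lemma bounded_clinear_ell2_shift: "bounded_clinear ell2_shift"
  by (rule bounded_clinearI[where C = 1])
    (auto intro!: ell2_eqI simp: norm_ell2_shift ell2_shift.rep_eq plus_ell2.rep_eq scaleC_ell2.rep_eq
      split: nat.split)

lemma bounded_clinear_ell2_backshift: "bounded_clinear ell2_backshift"
  by (rule bounded_clinearI[where C = 1])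
    (auto intro!: ell2_eqI
      simp: norm_ell2_backshift_le ell2_backshift.rep_eq plus_ell2.rep_eq scaleC_ell2.rep_eq)

lemma bounded_clinear_ell2_diag:
  assumes "Bseq w"
  shows "bounded_clinear (ell2_diag w)"
proof -
  obtain K where "K > 0" and K: "\<And>n. \<bar>w n\<bar> \<le> K" using assms by (auto simp: Bseq_def)
  show ?thesis
  proof (rule bounded_clinearI[where C = K])
    show "norm (ell2_diag w x) \<le> K * norm x" for x
      by (rule ell2_norm_le)
        (use \<open>K > 0\<close> K in \<open>auto simp: ell2_nth_diag[OF assms] norm_mult intro: mult_right_mono\<close>)
  qed (auto intro!: ell2_eqI
      simp: ell2_nth_diag[OF assms] plus_ell2.rep_eq scaleC_ell2.rep_eq algebra_simps)
qed

section \<open>The standard basis\<close>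

lemma ell2_shift_basis: "ell2_shift (ell2_basis n) = ell2_basis (Suc n)"
  by (rule ell2_eqI) (simp add: ell2_shift.rep_eq ell2_basis.rep_eq split: nat.split)

lemma ell2_diag_basis: "Bseq w \<Longrightarrow> ell2_diag w (ell2_basis n) = w n *\<^sub>R ell2_basis n"
  by (rule ell2_eqI) (simp add: ell2_nth_diag ell2_basis.rep_eq ell2_nth_scaleR)

lemma ell2_basis_expansion: "(\<lambda>N. \<Sum>n<N. ell2_nth x n *\<^sub>C ell2_basis n) \<longlonglongrightarrow> x"
proof -
  define y where "y N = (\<Sum>n<N. ell2_nth x n *\<^sub>C ell2_basis n)" for N
  have nth: "ell2_nth (x - y N) k = (if k < N then 0 else ell2_nth x k)" for N k
    by (simp add: y_def minus_ell2.rep_eq ell2_nth_sum scaleC_ell2.rep_eq ell2_basis.rep_eq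
        if_distrib[of "\<lambda>c. _ * c"] cong: if_cong)
  \<comment> \<open>The first \<open>N\<close> coordinates of the remainder vanish, so its squared
    norm is a tail of a convergent series.\<close>
  have "(norm (x - y N))\<^sup>2 = (\<Sum>n. (cmod (ell2_nth x (n + N)))\<^sup>2)" for N
    using suminf_split_initial_segment[OF ell2_summable[of "x - y N"], of N]
    by (simp add: ell2_norm_square nth)
  then have "(\<lambda>N. (norm (x - y N))\<^sup>2) \<longlonglongrightarrow> 0"
    using suminf_exist_split2[OF ell2_summable[of x]] by simp
  then have "(\<lambda>N. sqrt ((norm (x - y N))\<^sup>2)) \<longlonglongrightarrow> sqrt 0"
    by (rule tendsto_real_sqrt)
  then have "(\<lambda>N. norm (y N - x)) \<longlonglongrightarrow> 0" by (simp add: norm_minus_commute)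
  then have "y \<longlonglongrightarrow> x" using LIM_zero_iff tendsto_norm_zero_iff by blast
  then show ?thesis by (simp add: y_def[abs_def])
qed

text \<open>Linearity gives agreement on the partial sums of the basis expansion, and continuity
  carries it to the limit. This identifies operators that are given only by a definite description
  or by their values on the basis.\<close>

lemma bounded_clinear_eq_on_basis:
  fixes S T :: "ell2 \<Rightarrow> 'a::complex_inner"
  assumes S: "bounded_clinear S" and T: "bounded_clinear T"
    and eq: "\<And>n. S (ell2_basis n) = T (ell2_basis n)"
  shows "S = T"
proof
  fix x
  let ?y = "\<lambda>N. \<Sum>n<N. ell2_nth x n *\<^sub>C ell2_basis n"
  note lin = bounded_clinear_bounded_linear
  have "S (?y N) = T (?y N)" for N
    by (simp add: linear_sum[OF bounded_linear.linear[OF lin[OF S]]]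
        linear_sum[OF bounded_linear.linear[OF lin[OF T]]]
        bounded_clinear_scaleC[OF S] bounded_clinear_scaleC[OF T] eq)
  then show "S x = T x"
    using bounded_linear.tendsto[OF lin[OF S] ell2_basis_expansion[of x]]
      bounded_linear.tendsto[OF lin[OF T] ell2_basis_expansion[of x]]
    by (simp add: LIMSEQ_unique)
qed

section \<open>Weighted shifts\<close>

text \<open>The factors stand in the order of the polar decomposition: for bounded positive weights
  the diagonal factor is the absolute value and the shift is the partial isometry.\<close>

definition ell2_wshift :: "(nat \<Rightarrow> real) \<Rightarrow> ell2 \<Rightarrow> ell2" where
  "ell2_wshift w = ell2_shift \<circ> ell2_diag w"

lemma ell2_nth_wshift_0: "ell2_nth (ell2_wshift w x) 0 = 0"
  by (simp add: ell2_wshift_def ell2_shift.rep_eq)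

lemma ell2_nth_wshift_Suc:
  "Bseq w \<Longrightarrow> ell2_nth (ell2_wshift w x) (Suc n) = of_real (w n) * ell2_nth x n"
  by (simp add: ell2_wshift_def ell2_shift.rep_eq ell2_nth_diag)

context
  fixes w :: "nat \<Rightarrow> real"
  assumes w: "Bseq w"
begin

lemma bounded_clinear_ell2_wshift: "bounded_clinear (ell2_wshift w)"
  unfolding ell2_wshift_def
  by (intro bounded_clinear_compose bounded_clinear_ell2_shift bounded_clinear_ell2_diag w)

lemma ell2_wshift_basis: "ell2_wshift w (ell2_basis n) = w n *\<^sub>R ell2_basis (Suc n)"
  by (simp add: ell2_wshift_def ell2_diag_basis[OF w]
      bounded_clinear_scaleR[OF bounded_clinear_ell2_shift] ell2_shift_basis)

lemma ell2_wshift_unique: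
  assumes "bounded_clinear T" "\<And>n. T (ell2_basis n) = w n *\<^sub>R ell2_basis (Suc n)"
  shows "T = ell2_wshift w"
  by (rule bounded_clinear_eq_on_basis)
    (simp_all add: assms bounded_clinear_ell2_wshift ell2_wshift_basis)

section \<open>Adjoint, polar decomposition and mean transform of a weighted shift\<close>

lemma cadjoint_ell2_wshift: "cadjoint (ell2_wshift w) = ell2_diag w \<circ> ell2_backshift"
proof (rule cadjoint_eqI)
  show "bounded_clinear (ell2_diag w \<circ> ell2_backshift)"
    by (intro bounded_clinear_compose bounded_clinear_ell2_backshift bounded_clinear_ell2_diag w)
  show "cinner (ell2_wshift w x) y = cinner x ((ell2_diag w \<circ> ell2_backshift) y)" for x y
    \<comment> \<open>Coordinate 0 of a shifted vector vanishes, so dropping the head term moves the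
      index by one; the real weights are unchanged by conjugation.\<close>
    using suminf_split_head[OF ell2_summable_cinner[of "ell2_wshift w x" y]]
    by (simp add: cinner_ell2.rep_eq ell2_nth_wshift_0 ell2_nth_wshift_Suc[OF w] ell2_nth_diag[OF w]
        ell2_backshift.rep_eq mult_ac)
qed

context
  assumes pos: "\<And>n. 0 < w n"
begin

lemma positive_op_ell2_diag: "positive_op (ell2_diag w)"
proof -
  have "cinner (ell2_diag w x) x \<in> \<real>\<^sub>\<ge>\<^sub>0" for x
  proof -
    have eq: "ell2_nth (ell2_diag w x) n * cnj (ell2_nth x n)
        = of_real (w n * (cmod (ell2_nth x n))\<^sup>2)" for n
      using complex_norm_square[of "ell2_nth x n"] by (simp add: ell2_nth_diag[OF w] mult.assoc)
    have "summable (\<lambda>n. complex_of_real (w n * (cmod (ell2_nth x n))\<^sup>2))"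
      using ell2_summable_cinner[of "ell2_diag w x" x] by (simp only: eq)
    then have s: "summable (\<lambda>n. w n * (cmod (ell2_nth x n))\<^sup>2)"
      by (simp only: summable_of_real_iff)
    have "cinner (ell2_diag w x) x = of_real (\<Sum>n. w n * (cmod (ell2_nth x n))\<^sup>2)"
      by (simp only: cinner_ell2.rep_eq eq suminf_of_real[OF s])
    moreover have "0 \<le> (\<Sum>n. w n * (cmod (ell2_nth x n))\<^sup>2)"
      by (intro suminf_nonneg s) (simp add: pos less_imp_le)
    ultimately show ?thesis by simp
  qed
  then show ?thesis by (simp add: positive_op_def bounded_clinear_ell2_diag[OF w])
qed

text \<open>The adjoint times the shift is the square of the diagonal operator. Any positive root of
  it sends each basis vector to \<open>w n\<close> times itself by
  \<open>positive_sqrt_eigenvector\<close>, which gives uniqueness.\<close>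

lemma abs_op_ell2_wshift: "abs_op (ell2_wshift w) = ell2_diag w"
  unfolding abs_op_def sqrt_op_def
proof (rule the_equality)
  have sq: "cadjoint (ell2_wshift w) \<circ> ell2_wshift w = ell2_diag w \<circ> ell2_diag w"
    by (auto simp: fun_eq_iff cadjoint_ell2_wshift ell2_nth_diag[OF w] ell2_backshift.rep_eq
        ell2_nth_wshift_Suc[OF w] intro!: ell2_eqI)
  show "positive_op (ell2_diag w) \<and>
      ell2_diag w \<circ> ell2_diag w = cadjoint (ell2_wshift w) \<circ> ell2_wshift w"
    by (simp add: positive_op_ell2_diag sq)
  fix B assume B: "positive_op B \<and> B \<circ> B = cadjoint (ell2_wshift w) \<circ> ell2_wshift w"
  have "B (ell2_basis n) = w n *\<^sub>R ell2_basis n" for n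
  proof (rule positive_sqrt_eigenvector)
    have "B (B (ell2_basis n)) = ell2_diag w (ell2_diag w (ell2_basis n))"
      using B by (simp add: sq fun_eq_iff)
    then show "B (B (ell2_basis n)) = (w n * w n) *\<^sub>R ell2_basis n"
      by (simp add: ell2_diag_basis[OF w] bounded_clinear_scaleR[OF bounded_clinear_ell2_diag[OF w]])
  qed (use B pos in auto)
  then show "B = ell2_diag w"
    using B by (intro bounded_clinear_eq_on_basis)
      (auto simp: positive_op_def bounded_clinear_ell2_diag[OF w] ell2_diag_basis[OF w])
qed

text \<open>Positive weights make the kernel trivial, matching that of the isometric shift. For
  uniqueness, the factorisation is evaluated on the basis and the nonzero weight \<open>w n\<close>
  is cancelled.\<close>

lemma polar_isometry_ell2_wshift: "polar_isometry (ell2_wshift w) = ell2_shift"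
  unfolding polar_isometry_def abs_op_ell2_wshift
proof (rule the_equality)
  have "x = 0" if "ell2_wshift w x = 0" for x
  proof (rule ell2_eqI)
    show "ell2_nth x n = ell2_nth 0 n" for n
      using ell2_nth_wshift_Suc[OF w, of x n] pos[of n] by (simp add: that zero_ell2.rep_eq)
  qed
  then have ker: "{x. ell2_wshift w x = 0} = {0}"
    using bounded_clinear_zero[OF bounded_clinear_ell2_wshift] by auto
  have "ell2_shift x = 0 \<longleftrightarrow> x = 0" for x
    by (metis norm_ell2_shift norm_eq_zero)
  then show "partial_isometry ell2_shift \<and> {x. ell2_shift x = 0} = {x. ell2_wshift w x = 0} \<and>
      ell2_wshift w = ell2_shift \<circ> ell2_diag w"
    unfolding partial_isometry_def ker
    by (simp add: bounded_clinear_ell2_shift norm_ell2_shift) (simp add: ell2_wshift_def)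
  fix U assume U: "partial_isometry U \<and> {x. U x = 0} = {x. ell2_wshift w x = 0} \<and>
      ell2_wshift w = U \<circ> ell2_diag w"
  then have lin: "bounded_clinear U" by (simp add: partial_isometry_def)
  have "U (ell2_basis n) = ell2_shift (ell2_basis n)" for n
  proof -
    have "ell2_wshift w (ell2_basis n) = U (ell2_diag w (ell2_basis n))"
      using U by (metis comp_apply)
    then have "w n *\<^sub>R ell2_basis (Suc n) = w n *\<^sub>R U (ell2_basis n)"
      by (simp add: ell2_wshift_basis ell2_diag_basis[OF w] bounded_clinear_scaleR[OF lin])
    then show ?thesis using pos[of n] by (simp add: ell2_shift_basis)
  qed
  then show "U = ell2_shift"
    by (intro bounded_clinear_eq_on_basis lin bounded_clinear_ell2_shift)
qed

text \<open>The Duggal transform applies the diagonal operator after the shift, so it picks up the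
  weight at the target index: it is the shift with weights \<open>w (Suc n)\<close>.\<close>

lemma mean_transform_ell2_wshift:
  "mean_transform l (ell2_wshift w) = ell2_wshift (\<lambda>n. l * w n + (1 - l) * w (Suc n))"
proof -
  obtain K where "\<And>n. \<bar>w n\<bar> \<le> K" using w by (auto simp: Bseq_def)
  then have "\<bar>l * w n + (1 - l) * w (Suc n)\<bar> \<le> \<bar>l\<bar> * K + \<bar>1 - l\<bar> * K" for n
    by (intro order_trans[OF abs_triangle_ineq] add_mono) (auto simp: abs_mult intro: mult_left_mono)
  \<comment> \<open>Boundedness of the new weights has to be shown, since otherwise
    \<open>ell2_diag\<close> would be zero.\<close>
  then have B: "Bseq (\<lambda>n. l * w n + (1 - l) * w (Suc n))"
    by (intro BseqI') auto
  have D: "duggal (ell2_wshift w) = ell2_diag w \<circ> ell2_shift"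
    by (simp add: duggal_def abs_op_ell2_wshift polar_isometry_ell2_wshift)
  show ?thesis
  proof (intro ext ell2_eqI)
    show "ell2_nth (mean_transform l (ell2_wshift w) x) n
        = ell2_nth (ell2_wshift (\<lambda>n. l * w n + (1 - l) * w (Suc n)) x) n" for x n
      unfolding mean_transform_def D
      by (cases n) (simp_all add: plus_ell2.rep_eq ell2_nth_scaleR ell2_nth_wshift_0
          ell2_nth_wshift_Suc[OF w] ell2_nth_wshift_Suc[OF B]
          ell2_nth_diag[OF w] ell2_shift.rep_eq, simp add: algebra_simps)
  qed
qed

end

end

section \<open>Spectral radius for two alternating weights\<close>

lemma Bseq_alternating: "Bseq (\<lambda>n. if even n then a else b :: real)"
  by (rule BseqI'[where K = "\<bar>a\<bar> + \<bar>b\<bar>"]) auto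

text \<open>The square of the operator gives the upper bound. The bound is attained because
  \<open>sqrt (a * b)\<close> itself lies in the spectrum: subtracting it leaves an operator whose
  range misses \<open>ell2_basis 0\<close>.\<close>

lemma op_spectral_radius_alternating_wshift:
  fixes a b :: real
  assumes "0 < a" "0 < b"
  shows "op_spectral_radius (ell2_wshift (\<lambda>n. if even n then a else b)) = sqrt (a * b)"
proof -
  define w where "w = (\<lambda>n::nat. if even n then a else b)"
  have B: "Bseq w" unfolding w_def by (rule Bseq_alternating)
  let ?W = "ell2_wshift w"
  \<comment> \<open>Two consecutive indices consist of one even and one odd, so both weights are
    collected once wherever the walk starts.\<close>
  have WW: "?W (?W x) = (a * b) *\<^sub>R ell2_shift (ell2_shift x)" for x
  proof (rule ell2_eqI)
    show "ell2_nth (?W (?W x)) n = ell2_nth ((a * b) *\<^sub>R ell2_shift (ell2_shift x)) n" for n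
      by (cases "even n") (auto simp: ell2_nth_scaleR ell2_shift.rep_eq ell2_nth_wshift_0
          ell2_nth_wshift_Suc[OF B] fun_cong[OF w_def] split: nat.split)
  qed
  have le: "cmod z \<le> sqrt (a * b)" if "z \<in> op_spectrum ?W" for z
  proof -
    have "(cmod z)\<^sup>2 \<le> a * b \<or> z = 0"
      by (rule op_spectrum_bound_square[OF bounded_clinear_ell2_wshift[OF B] _ that])
        (use assms in \<open>simp add: WW norm_ell2_shift\<close>)
    then show ?thesis using assms by (auto intro: real_le_rsqrt)
  qed
  define r where "r = complex_of_real (sqrt (a * b))"
  have rr: "r * r = of_real a * of_real b"
    using assms by (simp add: r_def of_real_mult[symmetric] del: of_real_mult)
  have r0: "r \<noteq> 0" using assms by (simp add: r_def)
  have "r \<in> op_spectrum ?W"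
  proof (rule ccontr)
    assume "r \<notin> op_spectrum ?W"
    then obtain S where "(\<lambda>x. ?W x - r *\<^sub>C x) \<circ> S = id" by (auto simp: op_spectrum_def)
    then have "?W (S (ell2_basis 0)) - r *\<^sub>C S (ell2_basis 0) = ell2_basis 0"
      by (simp add: fun_eq_iff)
    then obtain y where y: "?W y - r *\<^sub>C y = ell2_basis 0" by blast
    have "ell2_nth (?W y - r *\<^sub>C y) 0 = 1" by (simp add: y ell2_basis.rep_eq)
    \<comment> \<open>Coordinate 0 of the equation reads
      \<open>- r * ell2_nth y 0 = 1\<close>.\<close>
    then have y0: "ell2_nth y 0 \<noteq> 0"
      by (auto simp: minus_ell2.rep_eq scaleC_ell2.rep_eq ell2_nth_wshift_0)
    have ySuc: "r * ell2_nth y (Suc n) = of_real (w n) * ell2_nth y n" for n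
    proof -
      have "ell2_nth (?W y - r *\<^sub>C y) (Suc n) = 0" by (simp add: y ell2_basis.rep_eq)
      then show ?thesis
        by (simp add: minus_ell2.rep_eq scaleC_ell2.rep_eq ell2_nth_wshift_Suc[OF B])
    qed
    \<comment> \<open>Two steps of the recursion multiply by \<open>a * b / r^2 = 1\<close>, so the
      even coordinates are a nonzero constant, which square-summability forbids.\<close>
    have "ell2_nth y (2 * n) = ell2_nth y 0" for n
    proof (induction n)
      case (Suc n)
      have "r * r * ell2_nth y (Suc (Suc (2 * n))) = of_real a * of_real b * ell2_nth y (2 * n)"
        using ySuc[of "2 * n"] ySuc[of "Suc (2 * n)"] by (simp add: w_def mult_ac)
      then show ?case using Suc assms by (simp add: rr)
    qed simp
    moreover have "(\<lambda>n. (cmod (ell2_nth y (2 * n)))\<^sup>2) \<longlonglongrightarrow> 0"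
      using LIMSEQ_subseq_LIMSEQ[OF summable_LIMSEQ_zero[OF ell2_summable[of y]], of "\<lambda>n. 2 * n"]
      by (simp add: strict_mono_def o_def)
    ultimately show False using y0 by (simp add: LIMSEQ_const_iff)
  qed
  moreover have "cmod r = sqrt (a * b)" using assms by (simp add: r_def)
  \<comment> \<open>The supremum is a maximum, attained at \<open>r\<close>, so nonemptiness and
    boundedness of the spectrum come along.\<close>
  ultimately have "op_spectral_radius ?W = sqrt (a * b)"
    unfolding op_spectral_radius_def by (intro cSup_eq_maximum) (auto intro: le image_eqI[where x = r])
  then show ?thesis by (simp add: w_def)
qed

section \<open>The strict inequality for weights 1 and \<epsilon>\<close>

theorem mainTheorem3:
  fixes \<epsilon> :: real and \<alpha> :: "nat \<Rightarrow> real"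
  assumes "0 < \<epsilon>" and "\<epsilon> < 1"
    and "\<And>n. \<alpha> n = (if even n then 1 else \<epsilon>)"
  shows "(\<forall>T :: ell2 \<Rightarrow> ell2.
            bounded_clinear T \<and> (\<forall>n. T (ell2_basis n) = \<alpha> n *\<^sub>R ell2_basis (Suc n)) \<longrightarrow>
            (\<forall>l::real. 0 < l \<and> l < 1 \<longrightarrow>
               op_spectral_radius (mean_transform l T) > op_spectral_radius T))
       \<and> (\<forall>l::real. 0 < l \<and> l < 1 \<longrightarrow>
            \<not> (\<forall>S :: ell2 \<Rightarrow> ell2. bounded_clinear S \<longrightarrow>
                 op_spectral_radius (mean_transform l S) \<le> op_spectral_radius S))"
proof -
  have \<alpha>: "\<alpha> = (\<lambda>n. if even n then 1 else \<epsilon>)" using assms(3) by auto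
  have B: "Bseq \<alpha>" unfolding \<alpha> by (rule Bseq_alternating)
  have pos: "0 < \<alpha> n" for n using assms by simp
  have gt: "op_spectral_radius (mean_transform l (ell2_wshift \<alpha>)) > op_spectral_radius (ell2_wshift \<alpha>)"
    if l: "0 < l" "l < 1" for l
  proof -
    \<comment> \<open>Advancing the index swaps the two weights, so the averaged weights alternate
      again and the same spectral radius formula applies.\<close>
    have eq: "(\<lambda>n. l * \<alpha> n + (1 - l) * \<alpha> (Suc n))
        = (\<lambda>n. if even n then l + (1 - l) * \<epsilon> else l * \<epsilon> + (1 - l))"
      by (auto simp: \<alpha>)
    have "0 < l + (1 - l) * \<epsilon>" "0 < l * \<epsilon> + (1 - l)"
      using l assms by (simp_all add: add_pos_pos)
    then have M: "op_spectral_radius (mean_transform l (ell2_wshift \<alpha>))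
        = sqrt ((l + (1 - l) * \<epsilon>) * (l * \<epsilon> + (1 - l)))"
      unfolding mean_transform_ell2_wshift[OF B pos] eq
      by (rule op_spectral_radius_alternating_wshift)
    have T: "op_spectral_radius (ell2_wshift \<alpha>) = sqrt (1 * \<epsilon>)"
      unfolding \<alpha> by (rule op_spectral_radius_alternating_wshift) (use assms in auto)
    have "(l + (1 - l) * \<epsilon>) * (l * \<epsilon> + (1 - l)) - \<epsilon> = l * (1 - l) * (1 - \<epsilon>)\<^sup>2"
      by (simp add: algebra_simps power2_eq_square)
    moreover have "0 < l * (1 - l) * (1 - \<epsilon>)\<^sup>2" using l assms by simp
    ultimately show ?thesis by (simp add: M T)
  qed
  show ?thesis
  proof (intro conjI allI impI)
    fix T :: "ell2 \<Rightarrow> ell2" and l :: real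
    assume T: "bounded_clinear T \<and> (\<forall>n. T (ell2_basis n) = \<alpha> n *\<^sub>R ell2_basis (Suc n))"
      and "0 < l \<and> l < 1"
    \<comment> \<open>Boundedness and the values on the basis determine \<open>T\<close>, so the
      concrete model can replace it.\<close>
    moreover have "T = ell2_wshift \<alpha>" using T by (intro ell2_wshift_unique[OF B]) auto
    ultimately show "op_spectral_radius (mean_transform l T) > op_spectral_radius T"
      using gt by simp
  next
    fix l :: real assume "0 < l \<and> l < 1"
    \<comment> \<open>One and the same shift refutes the general inequality for every
      \<open>l\<close>.\<close>
    then have "\<not> op_spectral_radius (mean_transform l (ell2_wshift \<alpha>))
        \<le> op_spectral_radius (ell2_wshift \<alpha>)"
      using gt[of l] by simp
    then show "\<not> (\<forall>S :: ell2 \<Rightarrow> ell2. bounded_clinear S \<longrightarrow>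
        op_spectral_radius (mean_transform l S) \<le> op_spectral_radius S)"
      using bounded_clinear_ell2_wshift[OF B] by blast
  qed
qed

end
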